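(* Let $A$ be a C*-algebra and $\mathcal{P}$ its set of annihilators ordered by inclusion. Then $\mathcal{P}$ is an ortholattice with orthocomplementation $X^\perp=\mathrm{Ann}(X)$, $X\in\mathcal{P}$. Moreover, if $A$ (acting on a Hilbert space $H$) satisfies condition (A), then $(\mathcal{P},\subseteq)$ is an orthomodular lattice.
   Context: For $S\subseteq A$, $\mathrm{Ann}(S)=\{a\in A: as+sa=0\ \forall s\in S\}$; $\mathcal{P}=\{\mathrm{Ann}(\mathrm{Ann}(S)): S\subseteq A_+\}$. An ortholattice is a lattice with $\mathbf{0},\mathbf{1}$ and a map $x\mapsto x^\perp$ with $x\wedge x^\perp=\mathbf{0}$, $x\vee x^\perp=\mathbf{1}$, $x^{\perp\perp}=x$, $(x\vee y)^\perp=x^\perp\wedge y^\perp$, $(x\wedge y)^\perp=x^\perp\vee y^\perp$; it is orthomodular if $x\le y$ implies $y=x\vee(y\wedge x^\perp)$. Condition (A) for a C*-algebra $A\subseteq B(H)$: for every $V\in\mathcal{P}$ and every maximal commutative *-subalgebra $V_o$ of $V$, the identity element of the weak closure $w(V_o)$ of $V_o$ in $B(H)$ coincides with the identity element of the weak closure $w(V)$ of $V$. *)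

theory Defs
  imports "HOL-Analysis.Analysis" "HOL-Algebra.Lattice"
begin

class complex_vec = real_vector +
  fixes scaleC :: "complex \<Rightarrow> 'a \<Rightarrow> 'a"
  assumes scaleC_add_right: "scaleC c (x + y) = scaleC c x + scaleC c y"
    and scaleC_add_left: "scaleC (c + d) x = scaleC c x + scaleC d x"
    and scaleC_scaleC: "scaleC c (scaleC d x) = scaleC (c * d) x"
    and scaleC_one: "scaleC 1 x = x"
    and scaleR_scaleC: "scaleR r x = scaleC (complex_of_real r) x"

class cstar_algebra = complex_vec + real_normed_algebra + banach +
  fixes adj :: "'a \<Rightarrow> 'a"
  assumes scaleC_mult_left: "scaleC c x * y = scaleC c (x * y)"
    and scaleC_mult_right: "x * scaleC c y = scaleC c (x * y)"
    and norm_scaleC: "norm (scaleC c x) = cmod c * norm x"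
    and adj_adj: "adj (adj x) = x"
    and adj_add: "adj (x + y) = adj x + adj y"
    and adj_scaleC: "adj (scaleC c x) = scaleC (cnj c) (adj x)"
    and adj_mult: "adj (x * y) = adj y * adj x"
    and cstar_identity: "norm (adj x * x) = (norm x)\<^sup>2"

class chilbert = complex_vec + banach +
  fixes cinner :: "'a \<Rightarrow> 'a \<Rightarrow> complex"
  assumes cinner_add_left: "cinner (x + y) z = cinner x z + cinner y z"
    and cinner_scaleC_left: "cinner (scaleC c x) y = c * cinner x y"
    and cinner_commute: "cinner y x = cnj (cinner x y)"
    and norm_cinner: "(norm x)\<^sup>2 = Re (cinner x x)"

definition positives :: "'a::cstar_algebra set" where
  "positives = {adj x * x | x. True}"

definition Ann :: "'a::cstar_algebra set \<Rightarrow> 'a set" where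
  "Ann S = {a. \<forall>s\<in>S. a * s + s * a = 0}"

definition annihilators :: "'a::cstar_algebra set set" where
  "annihilators = {Ann (Ann S) | S. S \<subseteq> positives}"

definition ann_poset :: "'a::cstar_algebra set gorder" where
  "ann_poset = \<lparr>carrier = annihilators, eq = (=), le = (\<subseteq>)\<rparr>"

definition ortholattice :: "'a gorder \<Rightarrow> ('a \<Rightarrow> 'a) \<Rightarrow> bool" where
  "ortholattice L c \<longleftrightarrow> bounded_lattice L \<and>
     (\<forall>x\<in>carrier L. c x \<in> carrier L) \<and>
     (\<forall>x\<in>carrier L. x \<sqinter>\<^bsub>L\<^esub> c x = \<bottom>\<^bsub>L\<^esub>) \<and>
     (\<forall>x\<in>carrier L. x \<squnion>\<^bsub>L\<^esub> c x = \<top>\<^bsub>L\<^esub>) \<and>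
     (\<forall>x\<in>carrier L. c (c x) = x) \<and>
     (\<forall>x\<in>carrier L. \<forall>y\<in>carrier L. c (x \<squnion>\<^bsub>L\<^esub> y) = c x \<sqinter>\<^bsub>L\<^esub> c y) \<and>
     (\<forall>x\<in>carrier L. \<forall>y\<in>carrier L. c (x \<sqinter>\<^bsub>L\<^esub> y) = c x \<squnion>\<^bsub>L\<^esub> c y)"

definition orthomodular :: "'a gorder \<Rightarrow> ('a \<Rightarrow> 'a) \<Rightarrow> bool" where
  "orthomodular L c \<longleftrightarrow> ortholattice L c \<and>
     (\<forall>x\<in>carrier L. \<forall>y\<in>carrier L. x \<sqsubseteq>\<^bsub>L\<^esub> y \<longrightarrow> y = x \<squnion>\<^bsub>L\<^esub> (y \<sqinter>\<^bsub>L\<^esub> c x))"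

definition bounded_op :: "('h::chilbert \<Rightarrow> 'h) \<Rightarrow> bool" where
  "bounded_op T \<longleftrightarrow> (\<forall>x y. T (x + y) = T x + T y) \<and>
     (\<forall>c x. T (scaleC c x) = scaleC c (T x)) \<and>
     (\<exists>K. \<forall>x. norm (T x) \<le> K * norm x)"

text \<open>A *-representation of \<open>A\<close> by bounded operators on \<open>H\<close>; \<open>A \<subseteq> B(H)\<close>
  corresponds to a faithful (injective) one.\<close>
definition star_rep :: "('a::cstar_algebra \<Rightarrow> 'h::chilbert \<Rightarrow> 'h) \<Rightarrow> bool" where
  "star_rep \<pi> \<longleftrightarrow> (\<forall>a. bounded_op (\<pi> a)) \<and>
     (\<forall>a b. \<pi> (a + b) = (\<lambda>x. \<pi> a x + \<pi> b x)) \<and>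
     (\<forall>c a. \<pi> (scaleC c a) = (\<lambda>x. scaleC c (\<pi> a x))) \<and>
     (\<forall>a b. \<pi> (a * b) = \<pi> a \<circ> \<pi> b) \<and>
     (\<forall>a x y. cinner (\<pi> (adj a) x) y = cinner x (\<pi> a y))"

definition wclosure :: "('h::chilbert \<Rightarrow> 'h) set \<Rightarrow> ('h \<Rightarrow> 'h) set" where
  "wclosure S = {T. bounded_op T \<and>
     (\<forall>F. finite F \<longrightarrow> (\<forall>\<epsilon>>0. \<exists>s\<in>S. \<forall>(x, y)\<in>F.
         cmod (cinner (T x - s x) y) < \<epsilon>))}"

definition is_identity_of :: "('h \<Rightarrow> 'h) set \<Rightarrow> ('h \<Rightarrow> 'h) \<Rightarrow> bool" where
  "is_identity_of M e \<longleftrightarrow> e \<in> M \<and> (\<forall>T\<in>M. e \<circ> T = T \<and> T \<circ> e = T)"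

definition star_subalgebra :: "'a::cstar_algebra set \<Rightarrow> bool" where
  "star_subalgebra S \<longleftrightarrow> 0 \<in> S \<and>
     (\<forall>x\<in>S. \<forall>y\<in>S. x + y \<in> S \<and> x * y \<in> S) \<and>
     (\<forall>c. \<forall>x\<in>S. scaleC c x \<in> S) \<and> (\<forall>x\<in>S. adj x \<in> S)"

definition commutative_set :: "'a::times set \<Rightarrow> bool" where
  "commutative_set S \<longleftrightarrow> (\<forall>x\<in>S. \<forall>y\<in>S. x * y = y * x)"

definition max_comm_star_subalgebra :: "'a::cstar_algebra set \<Rightarrow> 'a set \<Rightarrow> bool" where
  "max_comm_star_subalgebra W V \<longleftrightarrow> W \<subseteq> V \<and> star_subalgebra W \<and> commutative_set W \<and>
     (\<forall>U. star_subalgebra U \<and> commutative_set U \<and> W \<subseteq> U \<and> U \<subseteq> V \<longrightarrow> U = W)"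

definition condition_A :: "('a::cstar_algebra \<Rightarrow> 'h::chilbert \<Rightarrow> 'h) \<Rightarrow> bool" where
  "condition_A \<pi> \<longleftrightarrow> (\<forall>V\<in>annihilators. \<forall>W. max_comm_star_subalgebra W V \<longrightarrow>
     (\<exists>e. is_identity_of (wclosure (\<pi> ` W)) e \<and> is_identity_of (wclosure (\<pi> ` V)) e))"

end

theory Submission
  imports Defs
begin

text \<open>
  If \<open>s = adj x * x\<close> and \<open>a * s = - (s * a)\<close>, then \<open>a\<close> commutes with \<open>s * s\<close>, hence with the
  square root of \<open>s * s\<close>, which is \<open>s\<close> itself because \<open>adj x * x\<close> is positive; so
  \<open>a * s = s * a = 0\<close>. Annihilators of sets of positive elements are therefore two-sided
  annihilators: hereditary *-subalgebras on which \<open>Ann\<close> is an involution, and the ortholattice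
  laws follow from the Galois connection. The algebra need not have a unit, so the positivity of
  \<open>adj x * x\<close> is proved in its multiplier algebra.

  For orthomodularity it suffices that \<open>X \<subseteq> Y\<close> and \<open>Y \<inter> Ann X = {0}\<close> imply \<open>X = Y\<close>. Extend a
  maximal commutative *-subalgebra of \<open>X\<close> to one, \<open>U\<close>, of \<open>Y\<close>. By condition (A) the elements of
  \<open>U\<close> commute with the identity of the weak closure of \<open>X\<close>, so that \<open>F * d * adj F\<close> lies in
  \<open>Y \<inter> Ann X\<close> for \<open>F \<in> U\<close> and \<open>d \<in> Ann X\<close>. Hence \<open>U\<close> annihilates \<open>Ann X\<close>, and by condition (A)
  so does \<open>Y\<close>.
\<close>

section \<open>Elementary C*-algebra\<close>

lemma scaleC_zero_right [simp]: "scaleC c (0::'a::complex_vec) = 0"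
  using scaleC_add_right[of c 0 "0::'a"] by simp

lemma scaleC_minus_right: "scaleC c (- x) = - scaleC c (x::'a::complex_vec)"
  using scaleC_add_right[of c x "- x"] by (simp add: eq_neg_iff_add_eq_0 add.commute)

lemma scaleC_scaleR: "scaleC c (scaleR r x) = scaleR r (scaleC c (x::'a::complex_vec))"
  by (simp add: scaleR_scaleC scaleC_scaleC mult.commute)

lemma scaleC_minus_one: "scaleC (- 1) x = - (x::'a::complex_vec)"
  using scaleR_scaleC[of "-1" x] by simp

lemma adj_zero [simp]: "adj (0::'a::cstar_algebra) = 0"
  using adj_add[of 0 "0::'a"] by simp

lemma adj_minus: "adj (- x) = - adj (x::'a::cstar_algebra)"
  using adj_add[of x "- x"] by (simp add: eq_neg_iff_add_eq_0 add.commute)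

lemma adj_diff: "adj (x - y) = adj x - adj (y::'a::cstar_algebra)"
  using adj_add[of x "- y"] by (simp add: adj_minus)

lemma adj_scaleR: "adj (scaleR r x) = scaleR r (adj (x::'a::cstar_algebra))"
  by (simp add: scaleR_scaleC adj_scaleC)

lemma adj_mult_self_eq_0: "adj x * x = 0 \<longleftrightarrow> x = (0::'a::cstar_algebra)"
  using cstar_identity[of x] by auto

lemma mult_adj_self_eq_0: "x * adj x = 0 \<longleftrightarrow> x = (0::'a::cstar_algebra)"
  using adj_mult_self_eq_0[of "adj x"] by (metis adj_adj adj_zero)

lemma norm_adj [simp]: "norm (adj x) = norm (x::'a::cstar_algebra)"
proof -
  have *: "norm y \<le> norm (adj y)" for y :: 'a
  proof (cases "y = 0")
    case False
    have "norm y * norm y \<le> norm (adj y) * norm y"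
      by (metis cstar_identity norm_mult_ineq power2_eq_square)
    with False show ?thesis by simp
  qed simp
  show ?thesis using *[of x] *[of "adj x"] by (simp add: adj_adj)
qed

lemma bounded_linear_adj: "bounded_linear (adj :: 'a::cstar_algebra \<Rightarrow> 'a)"
  by (rule bounded_linear_intro[where K = 1]) (auto simp: adj_add adj_scaleR)

lemma bounded_linear_scaleC: "bounded_linear (scaleC c :: 'a::cstar_algebra \<Rightarrow> 'a)"
  by (rule bounded_linear_intro[where K = "cmod c"])
    (auto simp: scaleC_add_right scaleC_scaleR norm_scaleC mult.commute)

lemma sa_square_eq_0: "adj x = x \<Longrightarrow> x * x = 0 \<longleftrightarrow> x = (0::'a::cstar_algebra)"
  using adj_mult_self_eq_0[of x] by simp

text \<open>Left multiplication is faithful even without a unit: test with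
  \<open>c = adj (x - y)\<close>.\<close>

lemma eqI_mult_right:
  assumes "\<And>c. x * c = y * (c::'a::cstar_algebra)"
  shows "x = y"
proof -
  have "(x - y) * adj (x - y) = 0" using assms by (simp add: left_diff_distrib)
  then show ?thesis by (simp add: mult_adj_self_eq_0)
qed

section \<open>The multiplier algebra\<close>

text \<open>With the algebra-valued inner product \<open>adj b * c\<close>, this says that
  \<open>S\<close> is the adjoint of \<open>T\<close>.\<close>

definition adjoint_pair :: "('a::cstar_algebra \<Rightarrow>\<^sub>L 'a) \<Rightarrow> ('a \<Rightarrow>\<^sub>L 'a) \<Rightarrow> bool" where
  "adjoint_pair T S \<longleftrightarrow> (\<forall>b c. adj (T b) * c = adj b * S c)"

lemma adjoint_pair_sym: "adjoint_pair T S \<Longrightarrow> adjoint_pair S T"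
  unfolding adjoint_pair_def by (metis adj_adj adj_mult)

text \<open>The operator type gives only real linearity. A complex scalar can be pulled out once
  \<open>T\<close> has been moved to the other side of the pairing.\<close>

lemma adjoint_pair_scaleC:
  assumes "adjoint_pair T S"
  shows "T (scaleC c b) = scaleC c (T b)"
proof -
  have "adj (T (scaleC c b)) = adj (scaleC c (T b))"
  proof (rule eqI_mult_right)
    fix x
    show "adj (T (scaleC c b)) * x = adj (scaleC c (T b)) * x"
      using assms by (simp add: adjoint_pair_def adj_scaleC scaleC_mult_left)
  qed
  then show ?thesis by (metis adj_adj)
qed

text \<open>Half of the C*-identity for operators, obtained as on a Hilbert space from
  \<open>adj (T b) * T b = adj b * S (T b)\<close>.\<close>

lemma adjoint_pair_norm_sq:
  assumes "adjoint_pair T S"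
  shows "(norm T)\<^sup>2 \<le> norm (S o\<^sub>L T)"
proof -
  have "norm (T b) \<le> sqrt (norm (S o\<^sub>L T)) * norm b" for b
  proof -
    have "(norm (T b))\<^sup>2 = norm (adj b * (S o\<^sub>L T) b)"
      using assms by (simp add: adjoint_pair_def cstar_identity[symmetric])
    also have "\<dots> \<le> norm b * norm ((S o\<^sub>L T) b)"
      by (metis norm_adj norm_mult_ineq)
    also have "\<dots> \<le> norm b * (norm (S o\<^sub>L T) * norm b)"
      by (intro mult_left_mono norm_blinfun) auto
    also have "\<dots> = (sqrt (norm (S o\<^sub>L T)) * norm b)\<^sup>2"
      by (simp add: power_mult_distrib power2_eq_square)
    finally show ?thesis by (rule power2_le_imp_le) simp
  qed
  then have "norm T \<le> sqrt (norm (S o\<^sub>L T))"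
    by (intro norm_blinfun_bound) auto
  then have "(norm T)\<^sup>2 \<le> (sqrt (norm (S o\<^sub>L T)))\<^sup>2"
    by (intro power_mono) auto
  then show ?thesis by simp
qed

text \<open>By \<open>adjoint_pair_norm_sq\<close>, the square of \<open>norm T\<close> is at most
  \<open>norm S * norm T\<close>. Hence the norm of a multiplier can be read off its first
  component.\<close>

lemma adjoint_pair_norm:
  assumes "adjoint_pair T S"
  shows "norm S = norm T"
proof -
  have *: "norm T \<le> norm S" if "adjoint_pair T S" for T S :: "'a \<Rightarrow>\<^sub>L 'a"
  proof (cases "T = 0")
    case False
    have "norm T * norm T \<le> norm S * norm T"
      using adjoint_pair_norm_sq[OF that] norm_blinfun_compose[of S T]
      by (simp add: power2_eq_square)
    with False show ?thesis by simp
  qed simp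
  show ?thesis using *[OF assms] *[OF adjoint_pair_sym[OF assms]] by simp
qed

definition blinfun_scaleC :: "complex \<Rightarrow> 'a::cstar_algebra \<Rightarrow>\<^sub>L 'a" where
  "blinfun_scaleC c = Blinfun (scaleC c)"

lemma blinfun_scaleC_apply [simp]: "blinfun_apply (blinfun_scaleC c) x = scaleC c x"
  by (simp add: blinfun_scaleC_def bounded_linear_Blinfun_apply bounded_linear_scaleC)

lemma norm_blinfun_scaleC_compose:
  fixes T :: "'a::cstar_algebra \<Rightarrow>\<^sub>L 'a"
  shows "norm (blinfun_scaleC c o\<^sub>L T) = cmod c * norm T"
proof (rule antisym)
  have *: "norm (blinfun_scaleC c o\<^sub>L T) \<le> cmod c * norm T" for c and T :: "'a \<Rightarrow>\<^sub>L 'a"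
    by (rule norm_blinfun_bound)
      (simp_all add: norm_scaleC mult.assoc mult_left_mono norm_blinfun)
  show "norm (blinfun_scaleC c o\<^sub>L T) \<le> cmod c * norm T" by (rule *)
  \<comment> \<open>The lower bound is the upper bound applied to the inverse scalar.\<close>
  show "cmod c * norm T \<le> norm (blinfun_scaleC c o\<^sub>L T)"
  proof (cases "c = 0")
    case False
    have "T = blinfun_scaleC (inverse c) o\<^sub>L (blinfun_scaleC c o\<^sub>L T)"
      using False by (intro blinfun_eqI) (simp add: scaleC_scaleC scaleC_one)
    then have "norm T \<le> cmod (inverse c) * norm (blinfun_scaleC c o\<^sub>L T)"
      using *[of "inverse c" "blinfun_scaleC c o\<^sub>L T"] by simp
    then have "cmod c * norm T \<le> cmod c * (inverse (cmod c) * norm (blinfun_scaleC c o\<^sub>L T))"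
      by (intro mult_left_mono) (simp_all add: norm_inverse)
    also have "\<dots> = (cmod c * inverse (cmod c)) * norm (blinfun_scaleC c o\<^sub>L T)"
      by (simp only: mult.assoc)
    also have "\<dots> = norm (blinfun_scaleC c o\<^sub>L T)" using False by simp
    finally show ?thesis .
  qed simp
qed

definition blinfun_lmult :: "'a::cstar_algebra \<Rightarrow> 'a \<Rightarrow>\<^sub>L 'a" where
  "blinfun_lmult a = Blinfun ((*) a)"

lemma blinfun_lmult_apply [simp]: "blinfun_apply (blinfun_lmult a) x = a * x"
  by (simp add: blinfun_lmult_def bounded_linear_Blinfun_apply bounded_linear_mult_right)

text \<open>Since the second component is the adjoint of the first one, these are the adjointable
  operators of the algebra regarded as a Hilbert module over itself.\<close>

typedef (overloaded) 'a multiplier =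
  "{(T, S). adjoint_pair T (S :: 'a::cstar_algebra \<Rightarrow>\<^sub>L 'a)}"
  by (rule exI[of _ "(0, 0)"]) (simp add: adjoint_pair_def)

setup_lifting type_definition_multiplier

instantiation multiplier :: (cstar_algebra) real_normed_vector
begin

lift_definition zero_multiplier :: "'a multiplier" is "(0, 0)"
  by (simp add: adjoint_pair_def)

lift_definition plus_multiplier :: "'a multiplier \<Rightarrow> 'a multiplier \<Rightarrow> 'a multiplier"
  is "\<lambda>(T, S) (T', S'). (T + T', S + S')"
  by (auto simp: adjoint_pair_def blinfun.bilinear_simps adj_add algebra_simps)

lift_definition uminus_multiplier :: "'a multiplier \<Rightarrow> 'a multiplier"
  is "\<lambda>(T, S). (- T, - S)"
  by (auto simp: adjoint_pair_def blinfun.bilinear_simps adj_minus algebra_simps)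

lift_definition minus_multiplier :: "'a multiplier \<Rightarrow> 'a multiplier \<Rightarrow> 'a multiplier"
  is "\<lambda>(T, S) (T', S'). (T - T', S - S')"
  by (auto simp: adjoint_pair_def blinfun.bilinear_simps adj_diff algebra_simps)

lift_definition scaleR_multiplier :: "real \<Rightarrow> 'a multiplier \<Rightarrow> 'a multiplier"
  is "\<lambda>r (T, S). (scaleR r T, scaleR r S)"
  by (auto simp: adjoint_pair_def blinfun.bilinear_simps adj_scaleR)

lift_definition norm_multiplier :: "'a multiplier \<Rightarrow> real" is "\<lambda>(T, S). norm T" .

definition dist_multiplier :: "'a multiplier \<Rightarrow> 'a multiplier \<Rightarrow> real"
  where "dist_multiplier a b = norm (a - b)"

definition sgn_multiplier :: "'a multiplier \<Rightarrow> 'a multiplier"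
  where "sgn_multiplier a = scaleR (inverse (norm a)) a"

definition [code del]:
  "(uniformity :: ('a multiplier \<times> 'a multiplier) filter) =
    (INF e\<in>{0 <..}. principal {(x, y). dist x y < e})"

definition open_multiplier :: "'a multiplier set \<Rightarrow> bool"
  where [code del]: "open_multiplier U =
    (\<forall>x\<in>U. \<forall>\<^sub>F (x', y) in uniformity. x' = x \<longrightarrow> y \<in> U)"

instance
proof
  fix x y z :: "'a multiplier" and r s :: real
  show "dist x y = norm (x - y)" by (simp add: dist_multiplier_def)
  show "sgn x = scaleR (inverse (norm x)) x" by (simp add: sgn_multiplier_def)
  show "(norm x = 0) = (x = 0)"
    by transfer (auto dest: adjoint_pair_norm)
  show "norm (x + y) \<le> norm x + norm y"
    by transfer (auto simp: norm_triangle_ineq)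
  show "norm (scaleR r x) = \<bar>r\<bar> * norm x"
    by transfer auto
  show "x + y + z = x + (y + z)" by transfer (auto simp: algebra_simps)
  show "x + y = y + x" by transfer (auto simp: algebra_simps)
  show "0 + x = x" by transfer auto
  show "- x + x = 0" by transfer auto
  show "x - y = x + - y" by transfer auto
  show "scaleR r (x + y) = scaleR r x + scaleR r y" by transfer (auto simp: algebra_simps)
  show "scaleR (r + s) x = scaleR r x + scaleR s x" by transfer (auto simp: algebra_simps)
  show "scaleR r (scaleR s x) = scaleR (r * s) x" by transfer auto
  show "scaleR 1 x = x" by transfer auto
qed (simp_all add: uniformity_multiplier_def open_multiplier_def)

end

instantiation multiplier :: (cstar_algebra) "{real_normed_algebra, monoid_mult}"
begin

lift_definition one_multiplier :: "'a multiplier" is "(id_blinfun, id_blinfun)"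
  by (simp add: adjoint_pair_def)

lift_definition times_multiplier :: "'a multiplier \<Rightarrow> 'a multiplier \<Rightarrow> 'a multiplier"
  is "\<lambda>(T, S) (T', S'). (T o\<^sub>L T', S' o\<^sub>L S)"
  by (auto simp: adjoint_pair_def)

instance
proof
  fix x y z :: "'a multiplier" and r :: real
  show "x * y * z = x * (y * z)" by transfer (auto intro!: blinfun_eqI)
  show "(x + y) * z = x * z + y * z"
    by transfer (auto intro!: blinfun_eqI simp: blinfun.bilinear_simps)
  show "x * (y + z) = x * y + x * z"
    by transfer (auto intro!: blinfun_eqI simp: blinfun.bilinear_simps)
  show "scaleR r x * y = scaleR r (x * y)"
    by transfer (auto intro!: blinfun_eqI simp: blinfun.bilinear_simps)
  show "x * scaleR r y = scaleR r (x * y)"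
    by transfer (auto intro!: blinfun_eqI simp: blinfun.bilinear_simps)
  show "norm (x * y) \<le> norm x * norm y"
    by transfer (auto intro: norm_blinfun_compose)
  show "1 * x = x" by transfer (auto intro!: blinfun_eqI)
  show "x * 1 = x" by transfer (auto intro!: blinfun_eqI)
qed

end

instance multiplier :: (cstar_algebra) banach
proof
  fix X :: "nat \<Rightarrow> 'a multiplier"
  assume X: "Cauchy X"
  define T where "T n = fst (Rep_multiplier (X n))" for n
  define S where "S n = snd (Rep_multiplier (X n))" for n
  have TS: "adjoint_pair (T n) (S n)" for n
    using Rep_multiplier[of "X n"] by (auto simp: T_def S_def)
  have dT: "norm (X m - X n) = norm (T m - T n)" for m n
    by (auto simp: norm_multiplier.rep_eq minus_multiplier.rep_eq T_def split: prod.split)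
  \<comment> \<open>\<open>S m - S n\<close> is the adjoint of \<open>T m - T n\<close>, so both
    sequences are Cauchy together.\<close>
  have dS: "norm (T m - T n) = norm (S m - S n)" for m n
    by (rule sym, rule adjoint_pair_norm)
      (use TS[of m] TS[of n] in
        \<open>auto simp: adjoint_pair_def blinfun.bilinear_simps adj_diff algebra_simps\<close>)
  have "Cauchy T" "Cauchy S"
    using X by (simp_all add: Cauchy_iff dT dS)
  then obtain T' S' where lim: "T \<longlonglongrightarrow> T'" "S \<longlonglongrightarrow> S'"
    by (auto simp: Cauchy_convergent_iff convergent_def)
  have TS': "adjoint_pair T' S'"
    unfolding adjoint_pair_def
  proof (intro allI)
    fix b c
    have "(\<lambda>n. adj (T n b) * c) \<longlonglongrightarrow> adj (T' b) * c"
      by (intro tendsto_mult tendsto_const bounded_linear.tendsto[OF bounded_linear_adj]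
          blinfun.tendsto lim)
    moreover have "(\<lambda>n. adj b * S n c) \<longlonglongrightarrow> adj b * S' c"
      by (intro tendsto_mult tendsto_const blinfun.tendsto lim)
    moreover have "adj (T n b) * c = adj b * S n c" for n
      using TS[of n] by (simp add: adjoint_pair_def)
    ultimately show "adj (T' b) * c = adj b * S' c"
      using LIMSEQ_unique by auto
  qed
  have "norm (X n - Abs_multiplier (T', S')) = norm (T n - T')" for n
    using TS' by (auto simp: norm_multiplier.rep_eq minus_multiplier.rep_eq T_def
        Abs_multiplier_inverse split: prod.split)
  then have "X \<longlonglongrightarrow> Abs_multiplier (T', S')"
    using lim(1) by (simp add: LIMSEQ_iff)
  then show "convergent X" by (auto simp: convergent_def)
qed

instantiation multiplier :: (cstar_algebra) cstar_algebra
begin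

lift_definition scaleC_multiplier :: "complex \<Rightarrow> 'a multiplier \<Rightarrow> 'a multiplier"
  is "\<lambda>c (T, S). (blinfun_scaleC c o\<^sub>L T, blinfun_scaleC (cnj c) o\<^sub>L S)"
  by (auto simp: adjoint_pair_def adj_scaleC scaleC_mult_left scaleC_mult_right)

lift_definition adj_multiplier :: "'a multiplier \<Rightarrow> 'a multiplier"
  is "\<lambda>(T, S). (S, T)"
  by (auto intro: adjoint_pair_sym)

instance
proof
  fix x y :: "'a multiplier" and c d :: complex and r :: real
  show "scaleC c (x + y) = scaleC c x + scaleC c y"
    by transfer (auto intro!: blinfun_eqI simp: blinfun.bilinear_simps scaleC_add_right)
  show "scaleC (c + d) x = scaleC c x + scaleC d x"
    by transfer (auto intro!: blinfun_eqI simp: blinfun.bilinear_simps scaleC_add_left)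
  show "scaleC c (scaleC d x) = scaleC (c * d) x"
    by transfer (auto intro!: blinfun_eqI simp: scaleC_scaleC)
  show "scaleC 1 x = x"
    by transfer (auto intro!: blinfun_eqI simp: scaleC_one)
  show "scaleR r x = scaleC (complex_of_real r) x"
    by transfer (auto intro!: blinfun_eqI simp: blinfun.bilinear_simps scaleR_scaleC)
  show "scaleC c x * y = scaleC c (x * y)"
    by transfer
      (auto intro!: blinfun_eqI simp: adjoint_pair_scaleC[OF adjoint_pair_sym])
  show "x * scaleC c y = scaleC c (x * y)"
    by transfer (auto intro!: blinfun_eqI simp: adjoint_pair_scaleC)
  show "norm (scaleC c x) = cmod c * norm x"
    by transfer (auto simp: norm_blinfun_scaleC_compose)
  show "adj (adj x) = x" by transfer auto
  show "adj (x + y) = adj x + adj y" by transfer auto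
  show "adj (scaleC c x) = scaleC (cnj c) (adj x)" by transfer auto
  show "adj (x * y) = adj y * adj x" by transfer auto
  show "norm (adj x * x) = (norm x)\<^sup>2"
  proof (transfer, clarsimp)
    fix T S :: "'a \<Rightarrow>\<^sub>L 'a"
    assume TS: "adjoint_pair T S"
    show "norm (S o\<^sub>L T) = (norm T)\<^sup>2"
      using adjoint_pair_norm_sq[OF TS] norm_blinfun_compose[of S T]
      by (simp add: adjoint_pair_norm[OF TS] power2_eq_square)
  qed
qed

end

text \<open>The embedding of a possibly non-unital algebra into a unital one. It is injective by
  \<open>lmult_eq_0_iff\<close>, so a product that vanishes there vanishes in the algebra.\<close>

lift_definition lmult :: "'a::cstar_algebra \<Rightarrow> 'a multiplier"
  is "\<lambda>a. (blinfun_lmult a, blinfun_lmult (adj a))"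
  by (simp add: adjoint_pair_def adj_mult mult.assoc)

lemma lmult_add: "lmult (a + b) = lmult a + lmult b"
  by transfer (auto intro!: blinfun_eqI simp: blinfun.bilinear_simps adj_add algebra_simps)

lemma lmult_mult: "lmult (a * b) = lmult a * lmult b"
  by transfer (auto intro!: blinfun_eqI simp: adj_mult mult.assoc)

lemma lmult_adj: "lmult (adj a) = adj (lmult a)"
  by transfer (auto simp: adj_adj)

lemma lmult_eq_0_iff: "lmult a = 0 \<longleftrightarrow> a = 0"
proof
  assume "lmult a = 0"
  then have "blinfun_lmult a = 0" by transfer simp
  then have "a * adj a = 0" by (metis blinfun_lmult_apply zero_blinfun.rep_eq)
  then show "a = 0" by (simp add: mult_adj_self_eq_0)
qed (transfer, auto intro!: blinfun_eqI)

section \<open>Positivity in unital C*-algebras\<close>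

text \<open>The zero algebra, where \<open>norm 1 = 0\<close>, is included; so the unit comes from
  \<open>monoid_mult\<close> and not from \<open>real_normed_algebra_1\<close>.\<close>

class unital_cstar_algebra = cstar_algebra + monoid_mult

instance multiplier :: (cstar_algebra) unital_cstar_algebra ..

lemma adj_one [simp]: "adj (1::'a::unital_cstar_algebra) = 1"
  by (metis adj_adj adj_mult mult_1_right)

lemma norm_one_le: "norm (1::'a::unital_cstar_algebra) \<le> 1"
proof (cases "(1::'a) = 0")
  case False
  have "norm (1::'a) * norm (1::'a) = norm (1::'a)"
    using cstar_identity[of "1::'a"] by (simp add: power2_eq_square)
  with False show ?thesis by simp
qed simp

lemma adj_power: "adj (x ^ n) = adj x ^ n" for x :: "'a::unital_cstar_algebra"
  by (induction n) (simp_all add: adj_mult power_commutes)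

section \<open>Square roots from the binomial series of sqrt (1 - z)\<close>

definition sqrt_coeff :: "nat \<Rightarrow> real" where
  "sqrt_coeff k = ((1 / 2) gchoose k) * (- 1) ^ k"

lemma sqrt_coeff_0 [simp]: "sqrt_coeff 0 = 1"
  by (simp add: sqrt_coeff_def)

lemma gbinomial_half_sign: "((- 1 / 2 :: real) gchoose n) * (- 1) ^ n \<ge> 0"
proof -
  have "((- 1 / 2 :: real) gchoose n) * (- 1) ^ n = pochhammer (1 / 2) n / fact n"
    by (simp add: gbinomial_pochhammer flip: power_mult_distrib)
  also have "\<dots> \<ge> 0"
    by (intro divide_nonneg_nonneg pochhammer_nonneg) auto
  finally show ?thesis .
qed

lemma sqrt_coeff_Suc_le: "sqrt_coeff (Suc n) \<le> 0"
proof -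
  have "real (Suc n) * sqrt_coeff (Suc n) = - (1 / 2) * (((- 1 / 2 :: real) gchoose n) * (- 1) ^ n)"
    using gbinomial_absorption[of n "1 / 2 :: real"] by (simp add: sqrt_coeff_def)
  also have "\<dots> \<le> 0" using gbinomial_half_sign[of n] by linarith
  finally show ?thesis by (simp add: mult_le_0_iff)
qed

text \<open>All these coefficients are nonpositive, so the sum is 1 minus a partial sum of
  \<open>sqrt_coeff\<close>, and that partial sum has a nonnegative closed form. The bound 1 gives
  both absolute convergence on the closed unit ball and \<open>norm (1 - r) \<le> 1\<close> in
  \<open>sqrt_series\<close>.\<close>

lemma sum_sqrt_coeff_Suc: "(\<Sum>k<n. \<bar>sqrt_coeff (Suc k)\<bar>) \<le> 1"
proof -
  have "(\<Sum>k<n. \<bar>sqrt_coeff (Suc k)\<bar>) = - (\<Sum>k<n. sqrt_coeff (Suc k))"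
    by (simp add: abs_of_nonpos sqrt_coeff_Suc_le sum_negf)
  also have "\<dots> = 1 - (\<Sum>k\<le>n. sqrt_coeff k)"
    by (simp add: sum.lessThan_Suc_shift del: sum.lessThan_Suc flip: lessThan_Suc_atMost)
  also have "(\<Sum>k\<le>n. sqrt_coeff k) = (- 1) ^ n * ((- 1 / 2 :: real) gchoose n)"
    unfolding sqrt_coeff_def by (simp add: gbinomial_sum_lower_neg)
  finally show ?thesis using gbinomial_half_sign[of n] by (simp add: mult.commute)
qed

lemma summable_sqrt_coeff_Suc: "summable (\<lambda>k. \<bar>sqrt_coeff (Suc k)\<bar>)"
  by (rule summableI_nonneg_bounded[where x = 1]) (auto intro: sum_sqrt_coeff_Suc)

text \<open>Vandermonde's identity for 1/2 + 1/2 = 1: the square of the series is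
  \<open>1 - z\<close>.\<close>

lemma sqrt_coeff_convolution:
  "(\<Sum>i\<le>n. sqrt_coeff i * sqrt_coeff (n - i)) = (if n = 0 then 1 else if n = 1 then - 1 else 0)"
proof -
  have "(\<Sum>i\<le>n. sqrt_coeff i * sqrt_coeff (n - i)) =
      (\<Sum>i\<le>n. ((1 / 2) gchoose i) * ((1 / 2) gchoose (n - i)) * (- 1) ^ n)"
    by (intro sum.cong) (auto simp: sqrt_coeff_def simp flip: power_add)
  also have "\<dots> = (1 gchoose n) * (- 1) ^ n"
    using gbinomial_Vandermonde[of "1 / 2 :: real" "1 / 2" n]
    by (simp add: atLeast0AtMost flip: sum_distrib_right)
  also have "(1 gchoose n :: real) = of_nat (1 choose n)"
    by (simp add: binomial_gbinomial)
  also have "real (1 choose n) * (- 1) ^ n = (if n = 0 then 1 else if n = 1 then - 1 else 0)"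
    by (cases n; cases "n - 1") auto
  finally show ?thesis .
qed

text \<open>The series converges absolutely even for \<open>norm z = 1\<close>. Its coefficients are
  real, so the sum is self-adjoint, and whatever commutes with \<open>z\<close> commutes with every
  term.\<close>

lemma sqrt_series:
  fixes z :: "'a::unital_cstar_algebra"
  assumes z: "norm z \<le> 1" "adj z = z"
  obtains r where "adj r = r" "r * r = 1 - z" "norm (1 - r) \<le> 1"
    "\<And>w. w * z = z * w \<Longrightarrow> w * r = r * w"
proof
  define f where "f k = scaleR (sqrt_coeff k) (z ^ k)" for k
  define r where "r = suminf f"
  have norm_zk: "norm (z ^ Suc k) \<le> 1" for k
  proof (induction k)
    case (Suc k)
    have "norm (z ^ Suc (Suc k)) \<le> norm z * norm (z ^ Suc k)"
      by (metis norm_mult_ineq power_Suc)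
    also have "\<dots> \<le> 1 * 1" using Suc z by (intro mult_mono) auto
    finally show ?case by simp
  qed (use z in simp)
  have norm_f: "norm (f (Suc k)) \<le> \<bar>sqrt_coeff (Suc k)\<bar>" for k
    unfolding f_def norm_scaleR using mult_left_mono[OF norm_zk abs_ge_zero] by simp
  have sum_fS: "summable (\<lambda>k. norm (f (Suc k)))"
    by (rule summable_comparison_test'[OF summable_sqrt_coeff_Suc]) (use norm_f in auto)
  then have sum_norm: "summable (\<lambda>k. norm (f k))"
    by (rule summable_Suc_iff[THEN iffD1])
  then have sum_f: "summable f" by (rule summable_norm_cancel)
  have conv: "(\<Sum>i\<le>k. f i * f (k - i)) =
      scaleR (if k = 0 then 1 else if k = 1 then - 1 else 0) (z ^ k)" for k
    unfolding sqrt_coeff_convolution[symmetric] scaleR_sum_left f_def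
    by (intro sum.cong) (auto simp flip: power_add)
  have "(\<lambda>k. \<Sum>i\<le>k. f i * f (k - i)) sums (r * r)"
    using Cauchy_product_sums[OF sum_norm sum_norm] by (simp add: r_def)
  moreover have "(\<lambda>k. \<Sum>i\<le>k. f i * f (k - i)) sums (1 - z)"
    unfolding conv
    using sums_finite[of "{0, 1}" "\<lambda>k. scaleR (if k = 0 then 1 else if k = 1 then - 1 else 0) (z ^ k)"]
    by simp
  ultimately show "r * r = 1 - z" by (rule sums_unique2)
  have "adj r = (\<Sum>k. adj (f k))"
    unfolding r_def by (rule bounded_linear.suminf[OF bounded_linear_adj sum_f])
  also have "(\<lambda>k. adj (f k)) = f"
    by (rule ext) (simp add: f_def adj_scaleR adj_power z)
  finally show "adj r = r" by (simp add: r_def)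
  show "norm (1 - r) \<le> 1"
  proof -
    have "r = (\<Sum>k. f (Suc k)) + 1"
      using suminf_split_head[OF sum_f] by (simp add: r_def f_def)
    then have "norm (1 - r) = norm (\<Sum>k. f (Suc k))"
      by simp
    also have "\<dots> \<le> (\<Sum>k. norm (f (Suc k)))"
      by (rule summable_norm[OF sum_fS])
    also have "\<dots> \<le> (\<Sum>k. \<bar>sqrt_coeff (Suc k)\<bar>)"
      by (rule suminf_le[OF norm_f sum_fS summable_sqrt_coeff_Suc])
    also have "\<dots> \<le> 1"
      by (rule suminf_le_const[OF summable_sqrt_coeff_Suc sum_sqrt_coeff_Suc])
    finally show ?thesis .
  qed
  fix w assume w: "w * z = z * w"
  have "w * z ^ k = z ^ k * w" for k
    by (induction k) (simp_all add: w mult.assoc, metis w mult.assoc)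
  then show "w * r = r * w"
    unfolding r_def by (simp add: suminf_mult[OF sum_f, symmetric] suminf_mult2[OF sum_f] f_def)
qed

section \<open>Positive elements without spectral theory\<close>

text \<open>For self-adjoint \<open>h\<close>, the condition \<open>norm (t - h) \<le> t\<close> means that the
  spectrum lies in \<open>{0..2 * t}\<close>; in this form, closure under sums is the triangle inequality.\<close>

definition pos_cone :: "'a::unital_cstar_algebra set" where
  "pos_cone = {h. adj h = h \<and> (\<exists>t>0. norm (scaleR t 1 - h) \<le> t)}"

lemma pos_cone_adj: "h \<in> pos_cone \<Longrightarrow> adj h = h"
  by (simp add: pos_cone_def)

lemma pos_cone_add:
  assumes "h \<in> pos_cone" "g \<in> pos_cone"
  shows "h + g \<in> pos_cone"
proof -
  obtain t s where "t > 0" "s > 0" and ts: "norm (scaleR t 1 - h) \<le> t" "norm (scaleR s 1 - g) \<le> s"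
    using assms by (auto simp: pos_cone_def)
  have "scaleR (t + s) 1 - (h + g) = (scaleR t 1 - h) + (scaleR s 1 - g)"
    by (simp add: algebra_simps)
  then have "norm (scaleR (t + s) 1 - (h + g)) \<le> t + s"
    using ts by (metis add_mono norm_triangle_le)
  with \<open>t > 0\<close> \<open>s > 0\<close> assms show ?thesis
    unfolding pos_cone_def by (auto simp: adj_add intro!: exI[of _ "t + s"])
qed

lemma pos_cone_scaleR:
  assumes "h \<in> pos_cone" "c > 0"
  shows "scaleR c h \<in> pos_cone"
proof -
  obtain t where t: "t > 0" "norm (scaleR t 1 - h) \<le> t"
    using assms by (auto simp: pos_cone_def)
  have "scaleR (c * t) 1 - scaleR c h = scaleR c (scaleR t 1 - h)"
    by (simp add: algebra_simps)
  then have "norm (scaleR (c * t) 1 - scaleR c h) = c * norm (scaleR t 1 - h)"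
    using assms(2) by simp
  also have "\<dots> \<le> c * t" using t assms by simp
  finally show ?thesis using assms t unfolding pos_cone_def
    by (auto simp: adj_scaleR intro!: exI[of _ "c * t"])
qed

text \<open>Dividing by the \<open>t\<close> of the cone condition turns \<open>h\<close> into
  \<open>1 - z\<close> with \<open>norm z \<le> 1\<close>, where the binomial series applies. The
  root is scaled back by \<open>sqrt t\<close>.\<close>

lemma pos_cone_sqrt:
  assumes "h \<in> pos_cone"
  obtains r where "r \<in> pos_cone" "r * r = h" "\<And>w. w * h = h * w \<Longrightarrow> w * r = r * w"
proof -
  obtain t where t: "t > 0" "norm (scaleR t 1 - h) \<le> t"
    using assms by (auto simp: pos_cone_def)
  define z where "z = 1 - scaleR (inverse t) h"
  have "z = scaleR (inverse t) (scaleR t 1 - h)"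
    using t by (simp add: z_def algebra_simps)
  then have "norm z = inverse t * norm (scaleR t 1 - h)" using t by simp
  also have "\<dots> \<le> inverse t * t" using t by (intro mult_left_mono) auto
  finally have "norm z \<le> 1" using t by simp
  moreover have "adj z = z"
    using pos_cone_adj[OF assms] by (simp add: z_def adj_diff adj_scaleR)
  ultimately obtain r where r: "adj r = r" "r * r = 1 - z" "norm (1 - r) \<le> 1"
    and comm: "\<And>w. w * z = z * w \<Longrightarrow> w * r = r * w"
    using sqrt_series by blast
  show thesis
  proof
    have "r \<in> pos_cone" using r by (auto simp: pos_cone_def intro!: exI[of _ 1])
    then show "scaleR (sqrt t) r \<in> pos_cone" using t by (intro pos_cone_scaleR) auto
    have "scaleR (sqrt t) r * scaleR (sqrt t) r = scaleR (sqrt t * sqrt t) (r * r)" by simp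
    also have "\<dots> = scaleR t (1 - z)" using t by (simp only: r real_sqrt_mult_self abs_of_pos)
    also have "\<dots> = h" using t by (simp add: z_def)
    finally show "scaleR (sqrt t) r * scaleR (sqrt t) r = h" .
    show "w * scaleR (sqrt t) r = scaleR (sqrt t) r * w" if "w * h = h * w" for w
      using comm[of w] that by (simp add: z_def algebra_simps)
  qed
qed

text \<open>The squared modulus of a complex number with real part \<open>k\<close> and imaginary
  part \<open>c\<close>; commutation makes the cross terms cancel.\<close>

lemma adj_mult_self_commuting:
  fixes k c :: "'a::cstar_algebra"
  assumes "adj k = k" "adj c = c" "k * c = c * k"
  shows "adj (k + scaleC \<i> c) * (k + scaleC \<i> c) = k * k + c * c"
proof -
  have "scaleC (- \<i>) (c * k) + scaleC \<i> (c * k) = 0"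
    using scaleC_add_left[of "- \<i>" \<i> "c * k"] scaleR_scaleC[of 0 "c * k"] by simp
  then show ?thesis
    by (simp add: assms adj_add adj_scaleC algebra_simps scaleC_mult_left scaleC_mult_right
        scaleC_scaleC scaleC_one scaleC_add_right)
qed

lemma two_scaleC_imaginary_part: "scaleR 2 (scaleC \<i> c) = (k + scaleC \<i> c) - (k + scaleC \<i> (- c))"
  for k c :: "'a::cstar_algebra"
  by (simp add: scaleC_minus_right scaleR_2)

text \<open>Both \<open>k + scaleC \<i> c\<close> and \<open>k - scaleC \<i> c\<close> satisfy
  \<open>adj u * u = 1\<close>, so their norms are at most 1, and their difference is twice
  \<open>scaleC \<i> c\<close>.\<close>

lemma norm_square_complement:
  fixes k c :: "'a::unital_cstar_algebra"
  assumes "adj k = k" "adj c = c" "k * c = c * k" "k * k + c * c = 1"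
  shows "norm c \<le> 1"
proof -
  have *: "norm (k + scaleC \<i> d) \<le> 1"
    if "adj d = d" "k * d = d * k" "k * k + d * d = 1" for d
  proof -
    have "(norm (k + scaleC \<i> d))\<^sup>2 = norm (1::'a)"
      using that assms(1) by (simp flip: cstar_identity add: adj_mult_self_commuting)
    then have "(norm (k + scaleC \<i> d))\<^sup>2 \<le> 1" using norm_one_le by simp
    then show ?thesis by (simp add: power_le_one_iff abs_square_le_1)
  qed
  have "norm (scaleR 2 (scaleC \<i> c)) \<le> norm (k + scaleC \<i> c) + norm (k + scaleC \<i> (- c))"
    unfolding two_scaleC_imaginary_part[of c k] by (rule norm_triangle_ineq4)
  also have "\<dots> \<le> 1 + 1"
    using assms by (intro add_mono *) (simp_all add: adj_minus)
  finally show ?thesis by (simp add: norm_scaleC)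
qed

text \<open>After scaling to norm 1, the series gives a root \<open>c\<close> of
  \<open>1 - k' * k'\<close>. Then \<open>norm c \<le> 1\<close> by
  \<open>norm_square_complement\<close>, so \<open>norm (1 - k' * k') \<le> 1\<close>, which is the
  cone condition with \<open>t = 1\<close>.\<close>

lemma sa_square_in_pos_cone:
  fixes k :: "'a::unital_cstar_algebra"
  assumes k: "adj k = k"
  shows "k * k \<in> pos_cone"
proof (cases "k = 0")
  case True
  then show ?thesis using norm_one_le by (auto simp: pos_cone_def intro!: exI[of _ 1])
next
  case False
  define k' where "k' = scaleR (inverse (norm k)) k"
  have k': "adj k' = k'" "norm k' = 1" using False k by (simp_all add: k'_def adj_scaleR)
  have "norm (k' * k') \<le> 1" using norm_mult_ineq[of k' k'] k' by simp
  moreover have "adj (k' * k') = k' * k'" using k' by (simp add: adj_mult)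
  ultimately obtain c where c: "adj c = c" "c * c = 1 - k' * k'"
    and comm: "\<And>w. w * (k' * k') = (k' * k') * w \<Longrightarrow> w * c = c * w"
    using sqrt_series by blast
  have "k' * c = c * k'" by (rule comm) (simp add: mult.assoc)
  with k' c have "norm c \<le> 1" by (intro norm_square_complement[of k' c]) auto
  then have "norm (1 - k' * k') \<le> 1"
    using norm_mult_ineq[of c c] mult_mono[of "norm c" 1 "norm c" 1] by (simp flip: c(2))
  then have "k' * k' \<in> pos_cone"
    using k' by (auto simp: pos_cone_def adj_mult intro!: exI[of _ 1])
  then have "scaleR ((norm k)\<^sup>2) (k' * k') \<in> pos_cone"
    using False by (intro pos_cone_scaleR) auto
  moreover have "k = scaleR (norm k) k'" using False by (simp add: k'_def)
  then have "k * k = scaleR ((norm k)\<^sup>2) (k' * k')"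
    by (metis mult_scaleR_left mult_scaleR_right power2_eq_square scaleR_scaleR)
  ultimately show ?thesis by simp
qed

text \<open>For commuting roots \<open>k\<close> of \<open>h\<close> and \<open>l\<close> of
  \<open>- h\<close>, the elements \<open>k + scaleC \<i> l\<close> and
  \<open>k - scaleC \<i> l\<close> have squared modulus \<open>h - h = 0\<close>. So both vanish,
  and with them \<open>l\<close>.\<close>

lemma pos_cone_antisym:
  assumes "h \<in> pos_cone" "- h \<in> pos_cone"
  shows "h = 0"
proof -
  obtain k where k: "k \<in> pos_cone" "k * k = h" and commk: "\<And>w. w * h = h * w \<Longrightarrow> w * k = k * w"
    using pos_cone_sqrt[OF assms(1)] by metis
  obtain l where l: "l \<in> pos_cone" "l * l = - h"
    and comml: "\<And>w. w * (- h) = (- h) * w \<Longrightarrow> w * l = l * w"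
    using pos_cone_sqrt[OF assms(2)] by metis
  have "k * l = l * k" by (rule comml) (simp add: k(2)[symmetric] mult.assoc)
  have *: "k + scaleC \<i> d = 0" if "adj d = d" "k * d = d * k" "d * d = - h" for d
    using adj_mult_self_commuting[of k d] that pos_cone_adj[OF k(1)] k(2)
    by (simp add: adj_mult_self_eq_0)
  have "scaleR 2 (scaleC \<i> l) = 0"
    unfolding two_scaleC_imaginary_part[of l k]
    using *[of l] *[of "- l"] \<open>k * l = l * k\<close> l pos_cone_adj[OF l(1)] by (simp add: adj_minus)
  then have "norm (scaleC \<i> l) = 0" by simp
  then have "l = 0" by (simp add: norm_scaleC)
  with l show ?thesis by simp
qed

text \<open>Up to sign, \<open>p\<close> and \<open>q\<close> are twice the real and imaginary parts
  of \<open>y\<close>, and the sum in question is half of \<open>p * p + q * q\<close>.\<close>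

lemma pos_cone_adj_mult_add_mult_adj:
  fixes y :: "'a::unital_cstar_algebra"
  shows "adj y * y + y * adj y \<in> pos_cone"
proof -
  define p where "p = y + adj y"
  define q where "q = scaleC \<i> (y - adj y)"
  have "adj p = p" by (simp add: p_def adj_add adj_adj add.commute)
  moreover have "adj q = q"
    using scaleC_scaleC[of \<i> "- 1" "adj y - y"]
    by (simp add: q_def adj_scaleC adj_diff adj_adj scaleC_minus_one)
  ultimately have "p * p + q * q \<in> pos_cone"
    by (intro pos_cone_add sa_square_in_pos_cone)
  moreover have "q * q = - ((y - adj y) * (y - adj y))"
    by (simp add: q_def scaleC_mult_left scaleC_mult_right scaleC_scaleC scaleC_minus_one)
  then have "p * p + q * q = scaleR 2 (adj y * y + y * adj y)"
    by (simp add: p_def algebra_simps scaleR_2)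
  ultimately have "scaleR (1 / 2) (scaleR 2 (adj y * y + y * adj y)) \<in> pos_cone"
    by (intro pos_cone_scaleR[of "scaleR 2 _"]) auto
  then show ?thesis by simp
qed

text \<open>With \<open>z = y * m\<close>, both \<open>adj z * z\<close> and \<open>z * adj z\<close> are negatives of squares, so their sum
  lies in the cone and in its negative.\<close>

lemma adj_mult_self_eq_minus_square:
  fixes y :: "'a::unital_cstar_algebra"
  assumes m: "adj m = m" and y: "adj y * y = - (m * m)"
  shows "y = 0"
proof -
  define A where "A = y * adj y"
  define B where "B = m * m"
  have sa: "adj A = A" "adj B = B" by (simp_all add: A_def B_def adj_mult adj_adj m)
  define z where "z = y * m"
  have "adj z * z = m * (adj y * y) * m" by (simp add: z_def adj_mult m mult.assoc)
  then have 1: "adj z * z = - (B * B)" by (simp add: y B_def mult.assoc)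
  have "z * adj z = y * (m * m) * adj y" by (simp add: z_def adj_mult m mult.assoc)
  also have "m * m = - (adj y * y)" by (simp add: y)
  finally have 2: "z * adj z = - (A * A)" by (simp add: A_def mult.assoc)
  have AA: "A * A \<in> pos_cone" and BB: "B * B \<in> pos_cone"
    using sa by (auto intro: sa_square_in_pos_cone)
  have "- (A * A) = (adj z * z + z * adj z) + B * B" using 1 2 by simp
  also have "\<dots> \<in> pos_cone"
    by (intro pos_cone_add pos_cone_adj_mult_add_mult_adj BB)
  finally have "A * A = 0" using pos_cone_antisym AA by blast
  then show ?thesis using sa by (simp add: sa_square_eq_0 A_def mult_adj_self_eq_0)
qed

text \<open>With the modulus \<open>m\<close> of \<open>s\<close> and \<open>n = m - s\<close>, the element \<open>y = x * n\<close> satisfies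
  \<open>adj y * y = n * s * n = - (m * n\<^sup>2)\<close>, which is the negative of a square. Hence \<open>s = m\<close>.\<close>

lemma commutes_with_square_imp_commutes:
  fixes x a :: "'a::unital_cstar_algebra"
  defines "s \<equiv> adj x * x"
  assumes a: "a * (s * s) = (s * s) * a"
  shows "a * s = s * a"
proof -
  have sa: "adj s = s" by (simp add: s_def adj_mult adj_adj)
  obtain m where m: "m \<in> pos_cone" "m * m = s * s"
    and comm: "\<And>w. w * (s * s) = (s * s) * w \<Longrightarrow> w * m = m * w"
    using pos_cone_sqrt[OF sa_square_in_pos_cone[OF sa]] by metis
  have sm: "s * m = m * s" by (rule comm) (simp add: mult.assoc)
  \<comment> \<open>The root \<open>g\<close> of \<open>m\<close> exhibits \<open>n * m * n\<close>
    as the square of the self-adjoint element \<open>g * n\<close>.\<close>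
  obtain g where g: "g \<in> pos_cone" "g * g = m"
    and commg: "\<And>w. w * m = m * w \<Longrightarrow> w * g = g * w"
    using pos_cone_sqrt[OF m(1)] by metis
  have sg: "s * g = g * s" by (rule commg) (rule sm)
  have mg: "m * g = g * m" by (simp add: g(2)[symmetric] mult.assoc)
  have adj: "adj m = m" "adj g = g" using m g pos_cone_adj by auto
  define n where "n = m - s"
  have adj_n: "adj n = n" by (simp add: n_def adj_diff adj sa)
  have ng: "n * g = g * n" by (simp add: n_def algebra_simps sg mg)
  have nm: "n * m = m * n" by (simp add: n_def algebra_simps sm)
  have "n * s = - (n * m)" by (simp add: n_def algebra_simps sm m)
  then have nsn: "n * s * n = - (n * m * n)" by simp
  have gn: "adj (g * n) = g * n" by (simp add: adj_mult adj adj_n ng)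
  have gngn: "(g * n) * (g * n) = n * m * n"
  proof -
    have "n * m * n = (n * g) * (g * n)" by (simp add: g(2)[symmetric] mult.assoc)
    then show ?thesis by (simp add: ng)
  qed
  have "x * n = 0"
  proof (rule adj_mult_self_eq_minus_square[OF gn])
    have "adj (x * n) * (x * n) = n * s * n" by (simp add: s_def adj_mult adj_n mult.assoc)
    then show "adj (x * n) * (x * n) = - ((g * n) * (g * n))" by (simp add: nsn gngn)
  qed
  then have "s * n = 0" by (simp add: s_def mult.assoc)
  then have "n * s * n = 0" by (simp add: mult.assoc)
  with nsn have "m * n * n = 0" by (simp add: nm)
  with \<open>s * n = 0\<close> have "n * n * n = 0" by (simp add: n_def left_diff_distrib)
  then have "(n * n) * (n * n) = 0" by (metis mult.assoc mult_zero_left)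
  then have "n = 0" using adj_n by (simp add: sa_square_eq_0 adj_mult)
  then have "s = m" by (simp add: n_def)
  with comm[OF a] show ?thesis by simp
qed

section \<open>Annihilators\<close>

lemma anticommute_adj_mult_self:
  fixes a x :: "'a::cstar_algebra"
  assumes "a * (adj x * x) + (adj x * x) * a = 0"
  shows "a * (adj x * x) = 0" "(adj x * x) * a = 0"
proof -
  define s where "s = adj x * x"
  have as: "a * s = - (s * a)" using assms by (simp add: s_def eq_neg_iff_add_eq_0)
  have "a * (s * s) = (s * s) * a"
    by (metis (no_types, lifting) as minus_mult_left minus_mult_right minus_minus mult.assoc)
  \<comment> \<open>The unital result is applied in the multiplier algebra and brought back by
    injectivity of \<open>lmult\<close>.\<close>
  then have "lmult a * (lmult s * lmult s) = (lmult s * lmult s) * lmult a"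
    by (metis lmult_mult)
  then have "lmult a * lmult s = lmult s * lmult a"
    unfolding s_def lmult_mult lmult_adj by (rule commutes_with_square_imp_commutes)
  moreover have "lmult a * lmult s + lmult s * lmult a = 0"
    using assms by (simp add: s_def lmult_eq_0_iff flip: lmult_mult lmult_add)
  ultimately have "scaleR 2 (lmult a * lmult s) = 0" by (simp add: scaleR_2)
  then have "lmult (a * s) = 0" by (simp add: lmult_mult)
  then show "a * (adj x * x) = 0" by (simp add: lmult_eq_0_iff s_def)
  with assms show "(adj x * x) * a = 0" by simp
qed

definition two_sided_ann :: "'a::cstar_algebra set \<Rightarrow> 'a set" where
  "two_sided_ann S = {a. \<forall>s\<in>S. a * s = 0 \<and> s * a = 0}"

lemma Ann_positive: "S \<subseteq> positives \<Longrightarrow> Ann S = two_sided_ann S"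
  unfolding Ann_def two_sided_ann_def positives_def
  using anticommute_adj_mult_self by fastforce

lemma Ann_antimono: "S \<subseteq> T \<Longrightarrow> Ann T \<subseteq> Ann S"
  by (auto simp: Ann_def)

lemma subset_Ann_Ann: "S \<subseteq> Ann (Ann S)"
  by (auto simp: Ann_def add.commute)

lemma Ann_Ann_Ann: "Ann (Ann (Ann S)) = Ann S"
  using subset_Ann_Ann Ann_antimono by (metis subset_antisym)

lemma Ann_Un: "Ann (S \<union> T) = Ann S \<inter> Ann T"
  by (auto simp: Ann_def)

text \<open>Positive elements are self-adjoint, so taking adjoints swaps the two one-sided
  conditions.\<close>

lemma star_subalgebra_two_sided_ann:
  assumes "S \<subseteq> positives"
  shows "star_subalgebra (two_sided_ann S)"
proof -
  have "adj a \<in> two_sided_ann S" if "a \<in> two_sided_ann S" for a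
    unfolding two_sided_ann_def
  proof (intro CollectI ballI)
    fix s assume "s \<in> S"
    then have "adj s = s" using assms by (auto simp: positives_def adj_mult adj_adj)
    moreover have "a * s = 0" "s * a = 0"
      using that \<open>s \<in> S\<close> by (auto simp: two_sided_ann_def)
    ultimately show "adj a * s = 0 \<and> s * adj a = 0"
      by (metis adj_mult adj_zero)
  qed
  moreover have "a * b \<in> two_sided_ann S" if "a \<in> two_sided_ann S" "b \<in> two_sided_ann S" for a b
    using that by (auto simp: two_sided_ann_def mult.assoc) (simp flip: mult.assoc)
  ultimately show ?thesis
    unfolding star_subalgebra_def
    by (auto simp: two_sided_ann_def algebra_simps scaleC_mult_left scaleC_mult_right)
qed

text \<open>For \<open>n\<close> in \<open>N\<close>, both \<open>adj n * n\<close> and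
  \<open>n * adj n\<close> are positive elements of \<open>N\<close>, and the C*-identity turns
  \<open>c * (n * adj n) = 0\<close> into \<open>c * n = 0\<close>. This closes a circle of
  inclusions and reduces \<open>Ann N\<close> to the positive case.\<close>

lemma Ann_star_subalgebra:
  assumes "star_subalgebra N"
  shows "Ann N = two_sided_ann N" "Ann (N \<inter> positives) = Ann N"
proof -
  have 1: "two_sided_ann N \<subseteq> Ann N"
    by (auto simp: Ann_def two_sided_ann_def)
  have 2: "Ann N \<subseteq> Ann (N \<inter> positives)"
    by (rule Ann_antimono) simp
  have 3: "Ann (N \<inter> positives) \<subseteq> two_sided_ann N"
  proof
    fix c assume "c \<in> Ann (N \<inter> positives)"
    then have c: "c * s = 0" "s * c = 0" if "s \<in> N" "s \<in> positives" for s
      using that Ann_positive[of "N \<inter> positives"] by (auto simp: two_sided_ann_def)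
    show "c \<in> two_sided_ann N"
      unfolding two_sided_ann_def
    proof (intro CollectI ballI conjI)
      fix n assume n: "n \<in> N"
      have "adj n * n \<in> N" "n * adj n \<in> N"
        using n assms by (auto simp: star_subalgebra_def)
      moreover have "adj n * n \<in> positives" "n * adj n \<in> positives"
        unfolding positives_def using adj_adj[of n, symmetric] by auto metis
      ultimately have "c * (n * adj n) = 0" "(adj n * n) * c = 0" using c by auto
      then have "(c * n) * adj (c * n) = 0" "adj (n * c) * (n * c) = 0"
        by (simp_all add: adj_mult mult.assoc) (metis mult.assoc mult_zero_left)
      then show "c * n = 0" "n * c = 0"
        by (simp_all add: mult_adj_self_eq_0 adj_mult_self_eq_0)
    qed
  qed
  from 1 2 3 show "Ann N = two_sided_ann N" "Ann (N \<inter> positives) = Ann N" by blast+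
qed

lemma star_subalgebra_Ann: "S \<subseteq> positives \<Longrightarrow> star_subalgebra (Ann S)"
  by (simp add: Ann_positive star_subalgebra_two_sided_ann)

text \<open>The positive part of \<open>Ann S\<close> has the same annihilator as
  \<open>Ann S\<close>, so it generates \<open>Ann S\<close> as a double annihilator. Together with
  \<open>annihilatorsE\<close>, annihilators are exactly the sets \<open>Ann S\<close> with
  \<open>S\<close> positive.\<close>

lemma Ann_positive_in_annihilators:
  assumes "S \<subseteq> positives"
  shows "Ann S \<in> annihilators"
proof -
  have "Ann S = Ann (Ann (Ann S \<inter> positives))"
    using assms by (simp add: Ann_star_subalgebra(2) star_subalgebra_Ann Ann_Ann_Ann)
  then show ?thesis unfolding annihilators_def by blast
qed

lemma annihilatorsE:
  assumes "X \<in> annihilators"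
  obtains S where "S \<subseteq> positives" "X = Ann S"
proof -
  obtain T where T: "T \<subseteq> positives" "X = Ann (Ann T)"
    using assms by (auto simp: annihilators_def)
  then have "X = Ann (Ann T \<inter> positives)"
    by (simp add: Ann_star_subalgebra star_subalgebra_Ann)
  then show thesis using that[of "Ann T \<inter> positives"] by simp
qed

lemma star_subalgebra_annihilator: "X \<in> annihilators \<Longrightarrow> star_subalgebra X"
  by (auto elim: annihilatorsE intro: star_subalgebra_Ann)

lemma Ann_annihilator: "X \<in> annihilators \<Longrightarrow> Ann X = two_sided_ann X"
  by (intro Ann_star_subalgebra star_subalgebra_annihilator)

lemma Ann_in_annihilators:
  assumes "X \<in> annihilators"
  shows "Ann X \<in> annihilators"
proof -
  have "Ann X = Ann (X \<inter> positives)"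
    using assms by (simp add: Ann_star_subalgebra star_subalgebra_annihilator)
  then show ?thesis using Ann_positive_in_annihilators[of "X \<inter> positives"] by simp
qed

lemma Ann_Ann_annihilator: "X \<in> annihilators \<Longrightarrow> Ann (Ann X) = X"
  by (auto elim!: annihilatorsE simp: Ann_Ann_Ann)

lemma annihilator_Int_Ann:
  assumes "X \<in> annihilators"
  shows "X \<inter> Ann X = {0}"
proof -
  have "x = 0" if "x \<in> X" "x \<in> Ann X" for x
  proof -
    have "adj x \<in> X" using that assms star_subalgebra_annihilator
      by (auto simp: star_subalgebra_def)
    then have "x * adj x = 0" using that assms by (simp add: Ann_annihilator two_sided_ann_def)
    then show ?thesis by (simp add: mult_adj_self_eq_0)
  qed
  moreover have "0 \<in> X" "0 \<in> Ann X"
    using assms star_subalgebra_annihilator Ann_in_annihilators by (auto simp: star_subalgebra_def)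
  ultimately show ?thesis by auto
qed

text \<open>\<open>x\<close> alone is killed from the left and \<open>y\<close> alone from the
  right, so the middle factor is arbitrary.\<close>

lemma annihilator_hereditary:
  assumes "X \<in> annihilators" "x \<in> X" "y \<in> X"
  shows "x * a * y \<in> X"
proof -
  obtain S where S: "S \<subseteq> positives" "X = two_sided_ann S"
    using assms(1) by (metis annihilatorsE Ann_positive)
  have "x * a * y * s = 0 \<and> s * (x * a * y) = 0" if "s \<in> S" for s
  proof -
    have "y * s = 0" "s * x = 0" using that assms S by (auto simp: two_sided_ann_def)
    then show ?thesis by (simp add: mult.assoc) (simp flip: mult.assoc)
  qed
  then show ?thesis by (simp add: S two_sided_ann_def)
qed

lemma Int_in_annihilators:
  assumes "X \<in> annihilators" "Y \<in> annihilators"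
  shows "X \<inter> Y \<in> annihilators"
proof -
  obtain S T where "S \<subseteq> positives" "X = Ann S" "T \<subseteq> positives" "Y = Ann T"
    using assms by (auto elim!: annihilatorsE)
  then show ?thesis using Ann_positive_in_annihilators[of "S \<union> T"] by (simp add: Ann_Un)
qed

lemma UNIV_in_annihilators: "UNIV \<in> annihilators"
  using Ann_positive_in_annihilators[of "{}"] by (simp add: Ann_def)

lemma zero_in_annihilators: "{0 :: 'a::cstar_algebra} \<in> annihilators"
proof -
  have "Ann (UNIV :: 'a set) \<in> annihilators" "UNIV \<inter> Ann (UNIV :: 'a set) = {0}"
    by (intro Ann_in_annihilators annihilator_Int_Ann UNIV_in_annihilators)+
  then show ?thesis by simp
qed

section \<open>The lattice of annihilators\<close>

lemma ann_poset_simps [simp]: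
  "carrier ann_poset = annihilators" "x .=\<^bsub>ann_poset\<^esub> y \<longleftrightarrow> x = y"
  "x \<sqsubseteq>\<^bsub>ann_poset\<^esub> y \<longleftrightarrow> x \<subseteq> y"
  by (simp_all add: ann_poset_def)

lemma greatest_Lower_ann_poset:
  assumes "X \<in> annihilators" "Y \<in> annihilators"
  shows "greatest ann_poset (X \<inter> Y) (Lower ann_poset {X, Y})"
  using assms Int_in_annihilators[OF assms] by (auto simp: greatest_def Lower_def)

text \<open>\<open>Ann\<close> is an order-reversing involution on \<open>annihilators\<close>, so
  joins are given by De Morgan's law.\<close>

lemma least_Upper_ann_poset:
  assumes "X \<in> annihilators" "Y \<in> annihilators"
  shows "least ann_poset (Ann (Ann X \<inter> Ann Y)) (Upper ann_poset {X, Y})"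
proof -
  have closed: "Ann (Ann X \<inter> Ann Y) \<in> annihilators"
    using assms by (intro Ann_in_annihilators Int_in_annihilators)
  have upper: "X \<subseteq> Ann (Ann X \<inter> Ann Y)" "Y \<subseteq> Ann (Ann X \<inter> Ann Y)"
    using subset_Ann_Ann[of X] subset_Ann_Ann[of Y] Ann_antimono[of "Ann X \<inter> Ann Y"] by blast+
  have "Ann (Ann X \<inter> Ann Y) \<subseteq> Z" if "Z \<in> annihilators" "X \<subseteq> Z" "Y \<subseteq> Z" for Z
  proof -
    have "Ann (Ann X \<inter> Ann Y) \<subseteq> Ann (Ann Z)"
      using that by (intro Ann_antimono Int_greatest)
    with that show ?thesis by (simp add: Ann_Ann_annihilator)
  qed
  with closed upper assms show ?thesis
    by (auto simp: least_def Upper_def)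
qed

lemma bounded_lattice_ann_poset: "bounded_lattice (ann_poset :: 'a::cstar_algebra set gorder)"
proof
  show "\<exists>s. least ann_poset s (Upper ann_poset {x, y})"
    if "x \<in> carrier ann_poset" "y \<in> carrier ann_poset" for x y :: "'a set"
    using that least_Upper_ann_poset by auto
  show "\<exists>s. greatest ann_poset s (Lower ann_poset {x, y})"
    if "x \<in> carrier ann_poset" "y \<in> carrier ann_poset" for x y :: "'a set"
    using that greatest_Lower_ann_poset by auto
  show "\<exists>x. least (ann_poset :: 'a set gorder) x (carrier ann_poset)"
    using zero_in_annihilators star_subalgebra_annihilator
    by (auto simp: least_def star_subalgebra_def intro!: exI[of _ "{0}"])
  show "\<exists>x. greatest (ann_poset :: 'a set gorder) x (carrier ann_poset)"
    using UNIV_in_annihilators by (auto simp: greatest_def intro!: exI[of _ UNIV])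
qed (auto simp: ann_poset_def)

interpretation ann_lattice: bounded_lattice "ann_poset :: 'a::cstar_algebra set gorder"
  by (rule bounded_lattice_ann_poset)

lemma meet_ann_poset:
  assumes "X \<in> annihilators" "Y \<in> annihilators"
  shows "X \<sqinter>\<^bsub>ann_poset\<^esub> Y = X \<inter> Y"
  using ann_lattice.greatest_unique[OF ann_lattice.inf_of_two_greatest greatest_Lower_ann_poset]
    assms by (simp add: meet_def)

lemma join_ann_poset:
  assumes "X \<in> annihilators" "Y \<in> annihilators"
  shows "X \<squnion>\<^bsub>ann_poset\<^esub> Y = Ann (Ann X \<inter> Ann Y)"
  using ann_lattice.least_unique[OF ann_lattice.sup_of_two_least least_Upper_ann_poset]
    assms by (simp add: join_def)

lemma bottom_ann_poset: "\<bottom>\<^bsub>ann_poset\<^esub> = {0}"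
  using zero_in_annihilators star_subalgebra_annihilator
  by (intro ann_lattice.bottom_eq[symmetric]) (auto simp: star_subalgebra_def)

lemma top_ann_poset: "\<top>\<^bsub>ann_poset\<^esub> = UNIV"
  using UNIV_in_annihilators by (intro ann_lattice.top_eq[symmetric]) auto

lemma ortholattice_ann_poset: "ortholattice (ann_poset :: 'a::cstar_algebra set gorder) Ann"
proof -
  have "Ann {0} = (UNIV :: 'a set)" by (simp add: Ann_def)
  moreover have "Ann X \<inter> X = {0}" if "X \<in> annihilators" for X :: "'a set"
    using annihilator_Int_Ann[OF that] by blast
  ultimately show ?thesis
    unfolding ortholattice_def ann_poset_simps
    by (intro conjI ballI) (simp_all add: bounded_lattice_ann_poset meet_ann_poset
        join_ann_poset bottom_ann_poset top_ann_poset Ann_in_annihilators Int_in_annihilators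
        Ann_Ann_annihilator annihilator_Int_Ann)
qed

section \<open>Orthomodularity under condition (A)\<close>

lemma max_comm_star_subalgebraD:
  assumes "max_comm_star_subalgebra W V"
  shows "W \<subseteq> V" "star_subalgebra W" "commutative_set W"
  using assms by (simp_all add: max_comm_star_subalgebra_def)

text \<open>Zorn's lemma: any two elements of the union of a chain lie in a common member, so the
  algebraic laws pass to the union.\<close>

lemma exists_max_comm_star_subalgebra:
  assumes "star_subalgebra W" "commutative_set W" "W \<subseteq> V"
  obtains U where "W \<subseteq> U" "max_comm_star_subalgebra U V"
proof -
  define \<A> where "\<A> = {U. star_subalgebra U \<and> commutative_set U \<and> W \<subseteq> U \<and> U \<subseteq> V}"
  have "\<exists>M\<in>\<A>. \<forall>X\<in>\<A>. M \<subseteq> X \<longrightarrow> X = M"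
  proof (rule subset_Zorn_nonempty)
    show "\<A> \<noteq> {}" using assms by (auto simp: \<A>_def)
    fix \<C> assume C: "\<C> \<noteq> {}" "subset.chain \<A> \<C>"
    then have sub: "star_subalgebra U" "commutative_set U" "W \<subseteq> U" "U \<subseteq> V" if "U \<in> \<C>" for U
      using that by (auto simp: subset.chain_def \<A>_def)
    have common: "\<exists>U\<in>\<C>. x \<in> U \<and> y \<in> U" if xy: "x \<in> \<Union>\<C>" "y \<in> \<Union>\<C>" for x y
    proof -
      obtain A B where AB: "A \<in> \<C>" "x \<in> A" "B \<in> \<C>" "y \<in> B" using xy by blast
      then have "A \<subseteq> B \<or> B \<subseteq> A" using C(2) by (simp add: subset_chain_def)
      with AB show ?thesis by blast
    qed
    have "star_subalgebra (\<Union>\<C>)"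
      unfolding star_subalgebra_def
    proof (intro conjI ballI allI)
      show "0 \<in> \<Union>\<C>" using C(1) sub(1) by (auto simp: star_subalgebra_def)
    next
      fix x y assume "x \<in> \<Union>\<C>" "y \<in> \<Union>\<C>"
      then obtain U where "U \<in> \<C>" "x \<in> U" "y \<in> U" using common by blast
      then have "x + y \<in> U" "x * y \<in> U"
        using sub(1)[of U] by (simp_all add: star_subalgebra_def)
      with \<open>U \<in> \<C>\<close> show "x + y \<in> \<Union>\<C>" "x * y \<in> \<Union>\<C>" by blast+
    next
      fix c x assume "x \<in> \<Union>\<C>"
      then obtain U where "U \<in> \<C>" "x \<in> U" by blast
      then have "scaleC c x \<in> U" using sub(1)[of U] by (simp add: star_subalgebra_def)
      with \<open>U \<in> \<C>\<close> show "scaleC c x \<in> \<Union>\<C>" by blast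
    next
      fix x assume "x \<in> \<Union>\<C>"
      then obtain U where "U \<in> \<C>" "x \<in> U" by blast
      then have "adj x \<in> U" using sub(1)[of U] by (simp add: star_subalgebra_def)
      with \<open>U \<in> \<C>\<close> show "adj x \<in> \<Union>\<C>" by blast
    qed
    moreover have "commutative_set (\<Union>\<C>)"
      unfolding commutative_set_def
    proof (intro ballI)
      fix x y assume "x \<in> \<Union>\<C>" "y \<in> \<Union>\<C>"
      then obtain U where "U \<in> \<C>" "x \<in> U" "y \<in> U" using common by blast
      then show "x * y = y * x" using sub(2)[of U] by (simp add: commutative_set_def)
    qed
    ultimately show "\<Union>\<C> \<in> \<A>"
      using C(1) sub(3,4) by (auto simp: \<A>_def)
  qed
  then obtain M where M: "M \<in> \<A>" "\<And>X. X \<in> \<A> \<Longrightarrow> M \<subseteq> X \<Longrightarrow> X = M" by blast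
  have "max_comm_star_subalgebra M V"
    unfolding max_comm_star_subalgebra_def
  proof (intro conjI allI impI)
    fix U assume "star_subalgebra U \<and> commutative_set U \<and> M \<subseteq> U \<and> U \<subseteq> V"
    with M(1) show "U = M" by (intro M(2)) (auto simp: \<A>_def)
  qed (use M(1) in \<open>auto simp: \<A>_def\<close>)
  then show thesis using M(1) that by (auto simp: \<A>_def)
qed

section \<open>Representations and weak closures\<close>

lemma cinner_diff_left: "cinner (x - y) z = cinner x z - cinner y (z::'h::chilbert)"
  using cinner_add_left[of "x - y" y z] by simp

lemma eq_if_cinner_diff_less:
  fixes u v :: "'h::chilbert"
  assumes "\<And>y e. e > 0 \<Longrightarrow> cmod (cinner u y - cinner v y) < e"
  shows "u = v"
proof -
  \<comment> \<open>Otherwise the modulus of this number could serve as \<open>e\<close> and would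
    be less than itself.\<close>
  have "cinner u (u - v) - cinner v (u - v) = 0"
    using assms[of "cmod (cinner u (u - v) - cinner v (u - v))" "u - v"] by fastforce
  then have "(norm (u - v))\<^sup>2 = 0"
    by (simp add: norm_cinner cinner_diff_left)
  then show ?thesis by simp
qed

lemma star_rep_mult: "star_rep \<pi> \<Longrightarrow> \<pi> (a * b) = \<pi> a \<circ> \<pi> b"
  by (simp add: star_rep_def)

lemma star_rep_zero:
  assumes "star_rep \<pi>"
  shows "\<pi> 0 = (\<lambda>x. 0)"
proof
  fix x
  have "\<pi> (0 + 0) x = \<pi> 0 x + \<pi> 0 x" using assms by (simp only: star_rep_def)
  then show "\<pi> 0 x = 0" by simp
qed

lemma star_rep_apply_zero:
  assumes "star_rep \<pi>"
  shows "\<pi> a 0 = 0"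
  using assms star_rep_mult[of \<pi> a 0] star_rep_zero[of \<pi>] by (simp add: fun_eq_iff)

lemma star_rep_eq_0:
  assumes "star_rep \<pi>" "inj \<pi>" "\<And>x. \<pi> a x = 0"
  shows "a = 0"
proof -
  have "\<pi> a = \<pi> 0" using assms star_rep_zero[of \<pi>] by (simp add: fun_eq_iff)
  with assms(2) show ?thesis by (simp add: inj_eq)
qed

lemma in_wclosure:
  assumes "star_rep \<pi>" "s \<in> S"
  shows "\<pi> s \<in> wclosure (\<pi> ` S)"
proof -
  have "cinner (0::'b) y = 0" for y
    using cinner_add_left[of 0 "0::'b" y] by simp
  with assms show ?thesis
    unfolding wclosure_def star_rep_def by (fastforce intro!: bexI[of _ "\<pi> s"])
qed

text \<open>Multiplication by a fixed operator on either side is weakly continuous. Keeping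
  \<open>a\<close> and \<open>b\<close> separate covers commutation, with \<open>a = b\<close>, as
  well as annihilation, with one of them 0.\<close>

lemma wclosure_intertwines:
  assumes rep: "star_rep \<pi>" and T: "T \<in> wclosure (\<pi> ` S)"
    and ab: "\<And>s. s \<in> S \<Longrightarrow> a * s = s * b"
  shows "\<pi> a (T x) = T (\<pi> b x)"
proof (rule eq_if_cinner_diff_less)
  fix y and e :: real assume "e > 0"
  have adj: "cinner (\<pi> c u) v = cinner u (\<pi> (adj c) v)" for c u v
    using rep by (metis adj_adj star_rep_def)
  \<comment> \<open>Two test pairs are approximated at once: one for \<open>\<pi> a (T x)\<close>,
    with \<open>\<pi> a\<close> moved onto \<open>y\<close> as an adjoint, and one for
    \<open>T (\<pi> b x)\<close>.\<close>
  have "\<exists>t\<in>\<pi> ` S. \<forall>(u, v)\<in>{(x, \<pi> (adj a) y), (\<pi> b x, y)}. cmod (cinner (T u - t u) v) < e / 2"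
  proof -
    have "\<forall>F. finite F \<longrightarrow> (\<forall>\<epsilon>>0. \<exists>s\<in>\<pi> ` S. \<forall>(x, y)\<in>F. cmod (cinner (T x - s x) y) < \<epsilon>)"
      using T by (simp add: wclosure_def)
    then show ?thesis using \<open>e > 0\<close> by (meson finite.emptyI finite.insertI half_gt_zero)
  qed
  then obtain s where s: "s \<in> S" and
    1: "cmod (cinner (T x - \<pi> s x) (\<pi> (adj a) y)) < e / 2" and
    2: "cmod (cinner (T (\<pi> b x) - \<pi> s (\<pi> b x)) y) < e / 2"
    by auto
  have "\<pi> a (\<pi> s x) = \<pi> s (\<pi> b x)"
    using ab[OF s] star_rep_mult[OF rep, of a s] star_rep_mult[OF rep, of s b]
    by (simp add: fun_eq_iff)
  moreover have "cinner (T x - \<pi> s x) (\<pi> (adj a) y) =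
      cinner (\<pi> a (T x)) y - cinner (\<pi> a (\<pi> s x)) y"
    by (simp add: cinner_diff_left adj)
  ultimately have "cinner (\<pi> a (T x)) y - cinner (T (\<pi> b x)) y =
      cinner (T x - \<pi> s x) (\<pi> (adj a) y) - cinner (T (\<pi> b x) - \<pi> s (\<pi> b x)) y"
    by (simp add: cinner_diff_left)
  also have "cmod \<dots> < e / 2 + e / 2"
    using norm_triangle_ineq4 1 2 by (metis (no_types, lifting) add_strict_mono le_less_trans)
  finally show "cmod (cinner (\<pi> a (T x)) y - cinner (T (\<pi> b x)) y) < e" by simp
qed

lemma annihilator_eq_of_Int_Ann_trivial:
  fixes \<pi> :: "'a::cstar_algebra \<Rightarrow> 'h::chilbert \<Rightarrow> 'h" and X Y :: "'a set"
  assumes rep: "star_rep \<pi>" and "inj \<pi>" and condA: "condition_A \<pi>"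
    and X: "X \<in> annihilators" and Y: "Y \<in> annihilators" and "X \<subseteq> Y" and trivial: "Y \<inter> Ann X = {0}"
  shows "X = Y"
proof -
  have mult: "\<pi> (a * b) x = \<pi> a (\<pi> b x)" for a b x
    using star_rep_mult[OF rep] by simp
  note zero = star_rep_zero[OF rep] and apply_zero = star_rep_apply_zero[OF rep]
  note star_X = star_subalgebra_annihilator[OF X] and star_Y = star_subalgebra_annihilator[OF Y]
    and star_Ann = star_subalgebra_annihilator[OF Ann_in_annihilators[OF X]]
  have "star_subalgebra {0::'a}" "commutative_set {0::'a}" "{0} \<subseteq> X"
    using star_X by (auto simp: star_subalgebra_def commutative_set_def)
  then obtain W where "{0} \<subseteq> W" and W: "max_comm_star_subalgebra W X"
    by (rule exists_max_comm_star_subalgebra)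
  \<comment> \<open>Enlarging this same \<open>W\<close> makes every element of \<open>U\<close>
    commute with \<open>W\<close>.\<close>
  have "star_subalgebra W" "commutative_set W" "W \<subseteq> Y"
    using max_comm_star_subalgebraD[OF W] \<open>X \<subseteq> Y\<close> by simp_all
  then obtain U where "W \<subseteq> U" and U: "max_comm_star_subalgebra U Y"
    by (rule exists_max_comm_star_subalgebra)
  have "U \<subseteq> Y" and star_U: "star_subalgebra U" and comm_U: "commutative_set U"
    using max_comm_star_subalgebraD[OF U] by simp_all
  \<comment> \<open>Condition (A) gives \<open>e\<close> two roles: as a weak limit of elements of
    \<open>W\<close> it commutes with \<open>U\<close>, and it acts as the identity on all of
    \<open>X\<close>.\<close>
  obtain e where e: "is_identity_of (wclosure (\<pi> ` W)) e" "is_identity_of (wclosure (\<pi> ` X)) e"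
    using condA X W by (auto simp: condition_A_def)
  obtain f where f: "is_identity_of (wclosure (\<pi> ` U)) f" "is_identity_of (wclosure (\<pi> ` Y)) f"
    using condA Y U by (auto simp: condition_A_def)
  have e_X: "e (\<pi> x v) = \<pi> x v" "\<pi> x (e v) = \<pi> x v" if "x \<in> X" for x v
    using e(2) in_wclosure[OF rep that] by (auto simp: is_identity_of_def fun_eq_iff)
  have f_Y: "\<pi> y (f v) = \<pi> y v" if "y \<in> Y" for y v
    using f(2) in_wclosure[OF rep that] by (auto simp: is_identity_of_def fun_eq_iff)
  have e_U: "\<pi> F (e v) = e (\<pi> F v)" if "F \<in> U" for F v
  proof (rule wclosure_intertwines[OF rep])
    show "e \<in> wclosure (\<pi> ` W)" using e(1) by (simp add: is_identity_of_def)
    show "F * s = s * F" if "s \<in> W" for s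
      using that \<open>F \<in> U\<close> \<open>W \<subseteq> U\<close> comm_U by (auto simp: commutative_set_def)
  qed
  \<comment> \<open>\<open>e\<close> is also a weak limit of elements of \<open>X\<close>, which
    \<open>d\<close> annihilates on both sides.\<close>
  have e_Ann: "\<pi> d (e v) = 0" "e (\<pi> d v) = 0" if d: "d \<in> Ann X" for d v
  proof -
    have e_in: "e \<in> wclosure (\<pi> ` X)" using e(2) by (simp add: is_identity_of_def)
    have e0: "e 0 = 0"
      using wclosure_intertwines[OF rep e_in, of 0 0 0] by (simp add: zero)
    have "\<And>s. s \<in> X \<Longrightarrow> d * s = s * 0" "\<And>s. s \<in> X \<Longrightarrow> 0 * s = s * d"
      using d X by (auto simp: Ann_annihilator two_sided_ann_def)
    from this[THEN wclosure_intertwines[OF rep e_in], of v]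
    show "\<pi> d (e v) = 0" "e (\<pi> d v) = 0" by (simp_all add: zero e0)
  qed
  \<comment> \<open>Heredity keeps the product in \<open>Y\<close>, although \<open>d\<close> may
    lie outside. It annihilates \<open>X\<close> because an \<open>e\<close> inserted next to
    \<open>x\<close> can be moved across \<open>F\<close> or \<open>adj F\<close> until it meets
    \<open>d\<close>.\<close>
  have FdF: "F * d * adj F = 0" if F: "F \<in> U" and d: "d \<in> Ann X" for F d
  proof -
    have F': "adj F \<in> U" using F star_U by (simp add: star_subalgebra_def)
    have "F * d * adj F \<in> Y"
      using annihilator_hereditary[OF Y] F F' \<open>U \<subseteq> Y\<close> by blast
    moreover have "F * d * adj F \<in> two_sided_ann X"
      unfolding two_sided_ann_def
    proof (intro CollectI ballI conjI)
      fix x assume x: "x \<in> X"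
      show "F * d * adj F * x = 0"
      proof (rule star_rep_eq_0[OF rep \<open>inj \<pi>\<close>])
        fix v
        have "\<pi> (F * d * adj F * x) v = \<pi> F (\<pi> d (\<pi> (adj F) (e (\<pi> x v))))"
          by (simp add: mult e_X[OF x])
        then show "\<pi> (F * d * adj F * x) v = 0"
          by (simp add: e_U[OF F'] e_Ann[OF d] apply_zero)
      qed
      show "x * (F * d * adj F) = 0"
      proof (rule star_rep_eq_0[OF rep \<open>inj \<pi>\<close>])
        fix v
        have "\<pi> (x * (F * d * adj F)) v = \<pi> x (e (\<pi> F (\<pi> d (\<pi> (adj F) v))))"
          by (simp add: mult e_X[OF x])
        then show "\<pi> (x * (F * d * adj F)) v = 0"
          by (simp add: e_U[OF F, symmetric] e_Ann[OF d] apply_zero)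
      qed
    qed
    ultimately show ?thesis using trivial Ann_annihilator[OF X] by blast
  qed
  have Fg: "F * g = 0" if F: "F \<in> U" and g: "g \<in> Ann X" for F g
  proof -
    \<comment> \<open>The choice \<open>d = g * adj g\<close> turns \<open>F * d * adj F\<close>
      into \<open>(F * g) * adj (F * g)\<close>.\<close>
    have "g * adj g \<in> Ann X" using g star_Ann by (simp add: star_subalgebra_def)
    from FdF[OF F this] have "(F * g) * adj (F * g) = 0" by (simp add: adj_mult mult.assoc)
    then show ?thesis by (simp add: mult_adj_self_eq_0)
  qed
  have yg: "y * g = 0" if y: "y \<in> Y" and g: "g \<in> Ann X" for y g
  proof (rule star_rep_eq_0[OF rep \<open>inj \<pi>\<close>])
    fix v
    have f_in: "f \<in> wclosure (\<pi> ` U)" using f(1) by (simp add: is_identity_of_def)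
    \<comment> \<open>As a weak limit of elements of \<open>U\<close>, \<open>f\<close> kills the
      range of \<open>\<pi> g\<close>; as the identity on \<open>Y\<close>, it can be inserted
      between \<open>y\<close> and \<open>g\<close>.\<close>
    have "\<pi> 0 (f v) = f (\<pi> g v)"
      by (rule wclosure_intertwines[OF rep f_in]) (simp add: Fg g)
    then show "\<pi> (y * g) v = 0"
      by (metis f_Y[OF y] mult zero apply_zero)
  qed
  have "Ann X \<subseteq> two_sided_ann Y"
    unfolding two_sided_ann_def
  proof (intro subsetI CollectI ballI conjI)
    fix g y assume g: "g \<in> Ann X" and y: "y \<in> Y"
    show "y * g = 0" using yg[OF y g] .
    have "adj y * adj g = 0"
      using g y star_Y star_Ann by (intro yg) (simp_all add: star_subalgebra_def)
    then show "g * y = 0" by (metis adj_adj adj_mult adj_zero)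
  qed
  then have "Ann X \<subseteq> Ann Y" by (simp add: Ann_annihilator[OF Y])
  then have "Ann (Ann Y) \<subseteq> Ann (Ann X)" by (rule Ann_antimono)
  with \<open>X \<subseteq> Y\<close> show ?thesis by (simp add: Ann_Ann_annihilator X Y)
qed

text \<open>The join \<open>J\<close> of \<open>X\<close> and \<open>Z = Y \<inter> Ann X\<close>
  lies in \<open>Y\<close>, and \<open>Y \<inter> Ann J = Z \<inter> Ann Z = {0}\<close>. So
  \<open>annihilator_eq_of_Int_Ann_trivial\<close>, applied to \<open>J\<close> and
  \<open>Y\<close>, gives \<open>J = Y\<close>.\<close>

lemma orthomodular_ann_poset:
  fixes \<pi> :: "'a::cstar_algebra \<Rightarrow> 'h::chilbert \<Rightarrow> 'h"
  assumes "star_rep \<pi>" "inj \<pi>" "condition_A \<pi>"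
  shows "orthomodular (ann_poset :: 'a set gorder) Ann"
proof -
  have "Y = X \<squnion>\<^bsub>ann_poset\<^esub> (Y \<sqinter>\<^bsub>ann_poset\<^esub> Ann X)"
    if X: "X \<in> annihilators" and Y: "Y \<in> annihilators" and "X \<subseteq> Y" for X Y :: "'a set"
  proof -
    define Z where "Z = Y \<inter> Ann X"
    have Z: "Z \<in> annihilators"
      using X Y by (simp add: Z_def Int_in_annihilators Ann_in_annihilators)
    define J where "J = Ann (Ann X \<inter> Ann Z)"
    have lub: "least ann_poset J (Upper ann_poset {X, Z})"
      unfolding J_def by (rule least_Upper_ann_poset[OF X Z])
    have J: "J \<in> annihilators" using lub by (auto simp: least_def Upper_def)
    have "J \<subseteq> Y"
      using lub X Y Z \<open>X \<subseteq> Y\<close> by (auto simp: least_def Upper_def Z_def)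
    moreover have "Ann J = Ann X \<inter> Ann Z"
      unfolding J_def by (intro Ann_Ann_annihilator Int_in_annihilators Ann_in_annihilators X Z)
    then have "Y \<inter> Ann J = Z \<inter> Ann Z" by (auto simp: Z_def)
    then have "Y \<inter> Ann J = {0}" using annihilator_Int_Ann[OF Z] by simp
    ultimately have "J = Y"
      using annihilator_eq_of_Int_Ann_trivial[OF assms J Y] by blast
    then show ?thesis
      using X Y Z by (simp add: meet_ann_poset join_ann_poset Ann_in_annihilators J_def Z_def)
  qed
  then show ?thesis by (simp add: orthomodular_def ortholattice_ann_poset)
qed

theorem theorem12:
  fixes \<pi> :: "'a::cstar_algebra \<Rightarrow> 'h::chilbert \<Rightarrow> 'h"
  shows "ortholattice (ann_poset :: 'a set gorder) Ann \<and>
    (star_rep \<pi> \<and> inj \<pi> \<and> condition_A \<pi> \<longrightarrow> orthomodular (ann_poset :: 'a set gorder) Ann)"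
  using ortholattice_ann_poset orthomodular_ann_poset by blast

end
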